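(* Let $\rho$ be a left-c.e. semi-measure. Then $X\in2^\omega$ is weakly 2-random for $\rho$ (i.e., $X\in\mathsf{W2R}_\rho$) if and only if $X$ is blindly weakly 2-random for $\overline\rho$.
   Context: $2^{<\omega}$ is the set of finite binary strings, $\varepsilon$ the empty string, $[\![\sigma]\!]=\{X\in2^\omega:\sigma\preceq X\}$, $[\![S]\!]=\bigcup_{\sigma\in S}[\![\sigma]\!]$. A semi-measure is $\rho:2^{<\omega}\to[0,1]$ with $\rho(\varepsilon)=1$ and $\rho(\sigma)\ge\rho(\sigma0)+\rho(\sigma1)$; left-c.e. means its values are uniformly approximable from below by computable non-decreasing rational sequences. For $E\subseteq2^{<\omega}$, $\rho(E)=\sum_{\sigma\in E}\rho(\sigma)$. $X\in\mathsf{W2R}_\rho$ iff $X\notin\bigcap_i[\![U_i]\!]$ for every uniformly c.e. sequence $(U_i)$ of subsets of $2^{<\omega}$ with $\lim_i\rho(U_i)=0$. $\overline\rho(\sigma)=\inf_{n\ge|\sigma|}\sum_{\tau\succeq\sigma,\,|\tau|=n}\rho(\tau)$, which determines a Borel measure $\overline\rho$ on $2^\omega$ (of total mass possibly less than 1). $X$ is blindly weakly 2-random for $\overline\rho$ iff $X\notin\bigcap_i\mathcal U_i$ for every uniformly effectively open (uniformly $\Sigma^0_1$) sequence $(\mathcal U_i)$ of subsets of $2^\omega$ with $\lim_i\overline\rho(\mathcal U_i)=0$. *)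

theory Defs
  imports "HOL-Probability.Probability"
begin

datatype recf = Zr | Sc | Proj nat | Comp recf "recf list" | Prim recf recf | Mn recf

inductive reval :: "recf \<Rightarrow> nat list \<Rightarrow> nat \<Rightarrow> bool" where
  reval_Z: "reval Zr xs 0"
| reval_S: "reval Sc (x # xs) (Suc x)"
| reval_Proj: "i < length xs \<Longrightarrow> reval (Proj i) xs (xs ! i)"
| reval_Comp: "length ys = length gs \<Longrightarrow> (\<forall>i<length gs. reval (gs ! i) xs (ys ! i))
               \<Longrightarrow> reval f ys z \<Longrightarrow> reval (Comp f gs) xs z"
| reval_Prim0: "reval f xs y \<Longrightarrow> reval (Prim f g) (0 # xs) y"
| reval_PrimS: "reval (Prim f g) (n # xs) y \<Longrightarrow> reval g (n # y # xs) z
               \<Longrightarrow> reval (Prim f g) (Suc n # xs) z"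
| reval_Mn: "reval f (n # xs) 0 \<Longrightarrow> (\<forall>m<n. \<exists>y. reval f (m # xs) y \<and> y > 0)
               \<Longrightarrow> reval (Mn f) xs n"

definition computable2 :: "(nat \<Rightarrow> nat \<Rightarrow> nat) \<Rightarrow> bool" where
  "computable2 g \<longleftrightarrow> (\<exists>f. \<forall>x y. reval f [x, y] (g x y))"

text \<open>Finite binary strings are \<open>bool list\<close>; the empty string is \<open>[]\<close>;
  elements of Cantor space are \<open>nat \<Rightarrow> bool\<close>.  A fixed computable bijective coding
  of strings by natural numbers:\<close>
fun str_code :: "bool list \<Rightarrow> nat" where
  "str_code [] = 0"
| "str_code (b # s) = 2 * str_code s + (if b then 2 else 1)"

definition str_prefix_seq :: "bool list \<Rightarrow> (nat \<Rightarrow> bool) \<Rightarrow> bool" where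
  "str_prefix_seq \<sigma> X \<longleftrightarrow> (\<forall>i<length \<sigma>. X i = \<sigma> ! i)"

definition cyl :: "bool list \<Rightarrow> (nat \<Rightarrow> bool) set" where
  "cyl \<sigma> = {X. str_prefix_seq \<sigma> X}"

definition cylset :: "bool list set \<Rightarrow> (nat \<Rightarrow> bool) set" where
  "cylset S = (\<Union>\<sigma>\<in>S. cyl \<sigma>)"

definition unif_ce :: "(nat \<Rightarrow> bool list set) \<Rightarrow> bool" where
  "unif_ce U \<longleftrightarrow> (\<exists>f. \<forall>i \<sigma>. \<sigma> \<in> U i \<longleftrightarrow> (\<exists>y. reval f [i, str_code \<sigma>] y))"

definition unif_eff_open :: "(nat \<Rightarrow> (nat \<Rightarrow> bool) set) \<Rightarrow> bool" where
  "unif_eff_open \<U> \<longleftrightarrow> (\<exists>W. unif_ce W \<and> (\<forall>i. \<U> i = cylset (W i)))"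

definition computable_rat_fun :: "(bool list \<Rightarrow> nat \<Rightarrow> real) \<Rightarrow> bool" where
  "computable_rat_fun q \<longleftrightarrow> (\<exists>p m d. computable2 p \<and> computable2 m \<and> computable2 d \<and>
     (\<forall>\<sigma> s. q \<sigma> s = (real (p (str_code \<sigma>) s) - real (m (str_code \<sigma>) s))
                        / (real (d (str_code \<sigma>) s) + 1)))"

definition semimeasure :: "(bool list \<Rightarrow> real) \<Rightarrow> bool" where
  "semimeasure \<rho> \<longleftrightarrow> (\<forall>\<sigma>. 0 \<le> \<rho> \<sigma> \<and> \<rho> \<sigma> \<le> 1) \<and> \<rho> [] = 1 \<and>
     (\<forall>\<sigma>. \<rho> (\<sigma> @ [False]) + \<rho> (\<sigma> @ [True]) \<le> \<rho> \<sigma>)"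

definition left_ce :: "(bool list \<Rightarrow> real) \<Rightarrow> bool" where
  "left_ce \<rho> \<longleftrightarrow> (\<exists>q. computable_rat_fun q \<and> (\<forall>\<sigma>. incseq (q \<sigma>) \<and> q \<sigma> \<longlonglongrightarrow> \<rho> \<sigma>))"

definition left_ce_semimeasure :: "(bool list \<Rightarrow> real) \<Rightarrow> bool" where
  "left_ce_semimeasure \<rho> \<longleftrightarrow> semimeasure \<rho> \<and> left_ce \<rho>"

definition sm_set :: "(bool list \<Rightarrow> real) \<Rightarrow> bool list set \<Rightarrow> ennreal" where
  "sm_set \<rho> E = (\<integral>\<^sup>+ \<sigma>. ennreal (\<rho> \<sigma>) \<partial>count_space E)"

definition W2R :: "(bool list \<Rightarrow> real) \<Rightarrow> (nat \<Rightarrow> bool) \<Rightarrow> bool" where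
  "W2R \<rho> X \<longleftrightarrow> (\<forall>U. unif_ce U \<and> (\<lambda>i. sm_set \<rho> (U i)) \<longlonglongrightarrow> 0
                    \<longrightarrow> X \<notin> (\<Inter>i. cylset (U i)))"

definition rho_bar :: "(bool list \<Rightarrow> real) \<Rightarrow> bool list \<Rightarrow> real" where
  "rho_bar \<rho> \<sigma> = (INF n\<in>{length \<sigma>..}. \<Sum>\<tau>\<in>{\<tau>. length \<tau> = n \<and> prefix \<sigma> \<tau>}. \<rho> \<tau>)"

text \<open>The Borel measure on Cantor space determined by \<open>\<rho>bar\<close>: the measure on the
  \<sigma>-algebra generated by the cylinders (= the Borel sets) giving each cylinder
  \<open>\<lbrakk>\<sigma>\<rbrakk>\<close> mass \<open>\<rho>bar(\<sigma>)\<close> (unique when it exists).\<close>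
definition rho_bar_measure :: "(bool list \<Rightarrow> real) \<Rightarrow> (nat \<Rightarrow> bool) measure" where
  "rho_bar_measure \<rho> = (SOME M. space M = UNIV \<and> sets M = sigma_sets UNIV (range cyl) \<and>
                             (\<forall>\<sigma>. emeasure M (cyl \<sigma>) = ennreal (rho_bar \<rho> \<sigma>)))"

definition blind_W2R :: "(bool list \<Rightarrow> real) \<Rightarrow> (nat \<Rightarrow> bool) \<Rightarrow> bool" where
  "blind_W2R \<rho> X \<longleftrightarrow> (\<forall>\<U>. unif_eff_open \<U> \<and>
                          (\<lambda>i. emeasure (rho_bar_measure \<rho>) (\<U> i)) \<longlonglongrightarrow> 0
                          \<longrightarrow> X \<notin> (\<Inter>i. \<U> i))"

end

theory Submission
  imports Defs
begin

text \<open>Write \<open>\<rho>bar\<close> for \<open>rho_bar \<rho>\<close>. Since \<open>\<rho>bar \<le> \<rho>\<close>, countable subadditivity turns every test for \<open>\<rho>\<close> into a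
  test for \<open>\<rho>bar\<close>. Conversely, \<open>\<delta> = \<rho> - \<rho>bar\<close> is itself superadditive along the tree of strings, so
  the sum of \<open>\<delta>\<close> over an antichain of strings of length at least \<open>n\<close> is at most its sum over level \<open>n\<close>,
  and the latter tends to \<open>0\<close> by the definition of \<open>\<rho>bar\<close>. Hence if each effectively open \<open>\<U> n\<close> is
  presented by a uniformly c.e. antichain \<open>V n\<close> of strings longer than \<open>n\<close>, then \<open>\<rho>(V n)\<close> exceeds
  \<open>\<rho>bar(\<U> n)\<close> by a null sequence only.\<close>

section \<open>Recursive functions and stage-bounded evaluation\<close>

text \<open>Only argument lists of length \<open>k\<close> are constrained, so \<open>F\<close> may
  use \<open>hd\<close>, \<open>!\<close> or \<open>drop\<close> with whatever values these take on
  other lists.\<close>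

definition recursive_on :: "nat \<Rightarrow> (nat list \<Rightarrow> nat) \<Rightarrow> bool" where
  "recursive_on k F \<longleftrightarrow> (\<exists>f. \<forall>xs. length xs = k \<longrightarrow> reval f xs (F xs))"

text \<open>The inner layer of \<open>Comp\<close>: substituting, permuting and dropping arguments
  are all instances of composition with such a tuple.\<close>

definition recursive_vec :: "nat \<Rightarrow> nat \<Rightarrow> (nat list \<Rightarrow> nat list) \<Rightarrow> bool" where
  "recursive_vec k m T \<longleftrightarrow>
     (\<forall>xs. length xs = k \<longrightarrow> length (T xs) = m) \<and> (\<forall>i<m. recursive_on k (\<lambda>xs. T xs ! i))"

abbreviation decidable_on :: "nat \<Rightarrow> (nat list \<Rightarrow> bool) \<Rightarrow> bool" where
  "decidable_on k P \<equiv> recursive_on k (\<lambda>xs. of_bool (P xs))"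

section \<open>Closure properties of total recursive functions\<close>

lemma recursive_on_cong:
  assumes "recursive_on k F" "\<And>xs. length xs = k \<Longrightarrow> F xs = G xs"
  shows "recursive_on k G"
  using assms unfolding recursive_on_def by metis

lemma recursive_on_nth: "i < k \<Longrightarrow> recursive_on k (\<lambda>xs. xs ! i)"
  unfolding recursive_on_def by (metis reval_Proj)

lemma recursive_on_comp:
  assumes "recursive_on m F" "recursive_vec k m T"
  shows "recursive_on k (\<lambda>xs. F (T xs))"
proof -
  obtain f where f: "\<And>ys. length ys = m \<Longrightarrow> reval f ys (F ys)"
    using assms(1) unfolding recursive_on_def by blast
  obtain g where g: "\<And>i xs. i < m \<Longrightarrow> length xs = k \<Longrightarrow> reval (g i) xs (T xs ! i)"
    using assms(2) unfolding recursive_on_def recursive_vec_def by metis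
  have "reval (Comp f (map g [0..<m])) xs (F (T xs))" if "length xs = k" for xs
    using assms(2) that f g by (intro reval_Comp[of "T xs"]) (auto simp: recursive_vec_def)
  thus ?thesis unfolding recursive_on_def by blast
qed

lemma recursive_vec_Nil: "recursive_vec k 0 (\<lambda>xs. [])"
  by (simp add: recursive_vec_def)

lemma recursive_vec_Cons:
  assumes "recursive_on k G" "recursive_vec k m T"
  shows "recursive_vec k (Suc m) (\<lambda>xs. G xs # T xs)"
  using assms unfolding recursive_vec_def by (auto simp: less_Suc_eq_0_disj)

lemma recursive_vec_drop: "recursive_vec (j + m) m (drop j)"
proof -
  have "recursive_on (j + m) (\<lambda>xs. drop j xs ! i)" if "i < m" for i
    by (rule recursive_on_cong[OF recursive_on_nth[of "j + i"]]) (use that in auto)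
  thus ?thesis by (auto simp: recursive_vec_def)
qed

lemma recursive_vec_id: "recursive_vec k k (\<lambda>xs. xs)"
  by (auto simp: recursive_vec_def recursive_on_nth)

lemma recursive_vec_map:
  assumes "\<And>g. g \<in> set gs \<Longrightarrow> recursive_on k (H g)"
  shows "recursive_vec k (length gs) (\<lambda>xs. map (\<lambda>g. H g xs) gs)"
  using assms by (auto simp: recursive_vec_def)

lemma recursive_on_drop:
  assumes "recursive_on k F"
  shows "recursive_on (j + k) (\<lambda>xs. F (drop j xs))"
  by (rule recursive_on_comp[OF assms recursive_vec_drop])

lemma recursive_on_Suc:
  assumes "recursive_on k F" shows "recursive_on k (\<lambda>xs. Suc (F xs))"
proof -
  have "recursive_on 1 (\<lambda>ys. Suc (ys ! 0))"
    unfolding recursive_on_def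
    by (rule exI[of _ Sc]) (auto simp: length_Suc_conv intro: reval_S)
  from recursive_on_comp[OF this, of k "\<lambda>xs. [F xs]"] assms show ?thesis
    by (simp add: recursive_vec_def)
qed

lemma recursive_on_const: "recursive_on k (\<lambda>xs. c)"
proof (induction c)
  case 0
  thus ?case unfolding recursive_on_def using reval_Z by blast
qed (rule recursive_on_Suc)

text \<open>\<open>Prim\<close> recurses on its first argument. Composing with
  \<open>N xs # xs\<close> makes the number of iterations a computed value while \<open>xs\<close>
  stays available as parameters; the step function sees the counter, then the previous value, then
  the parameters.\<close>

lemma recursive_on_rec_nat:
  assumes F: "recursive_on k F" and G: "recursive_on (Suc (Suc k)) G" and N: "recursive_on k N"
  shows "recursive_on k (\<lambda>xs. rec_nat (F xs) (\<lambda>m r. G (m # r # xs)) (N xs))"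
proof -
  obtain f where f: "\<And>xs. length xs = k \<Longrightarrow> reval f xs (F xs)"
    using F unfolding recursive_on_def by blast
  obtain g where g: "\<And>xs. length xs = Suc (Suc k) \<Longrightarrow> reval g xs (G xs)"
    using G unfolding recursive_on_def by blast
  have "reval (Prim f g) (n # xs) (rec_nat (F xs) (\<lambda>m r. G (m # r # xs)) n)" if "length xs = k" for n xs
    using that by (induction n) (auto intro: reval_Prim0 reval_PrimS[OF _ g] f)
  hence "recursive_on (Suc k) (\<lambda>ys. rec_nat (F (tl ys)) (\<lambda>m r. G (m # r # tl ys)) (hd ys))"
    unfolding recursive_on_def by (intro exI[of _ "Prim f g"]) (auto simp: length_Suc_conv)
  from recursive_on_comp[OF this recursive_vec_Cons[OF N recursive_vec_id]] show ?thesis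
    by simp
qed

lemma recursive_on_add:
  assumes "recursive_on k F" "recursive_on k G"
  shows "recursive_on k (\<lambda>xs. F xs + G xs)"
proof -
  have eq: "rec_nat a (\<lambda>m r. Suc r) n = a + n" for a n :: nat
    by (induction n) auto
  show ?thesis
    using recursive_on_rec_nat[OF assms(1) recursive_on_Suc[OF recursive_on_nth[of 1]] assms(2)]
    by (simp add: eq)
qed

lemma recursive_on_pred:
  assumes "recursive_on k F" shows "recursive_on k (\<lambda>xs. F xs - 1)"
proof -
  have eq: "rec_nat 0 (\<lambda>m r. m) n = n - 1" for n :: nat
    by (cases n) auto
  show ?thesis
    using recursive_on_rec_nat[OF recursive_on_const[of k 0] recursive_on_nth[of 0] assms]
    by (simp add: eq)
qed

lemma recursive_on_diff:
  assumes "recursive_on k F" "recursive_on k G"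
  shows "recursive_on k (\<lambda>xs. F xs - G xs)"
proof -
  have eq: "rec_nat a (\<lambda>m r. r - Suc 0) n = a - n" for a n :: nat
    by (induction n) auto
  show ?thesis
    using recursive_on_rec_nat[OF assms(1) recursive_on_pred[OF recursive_on_nth[of 1]] assms(2)]
    by (simp add: eq)
qed

text \<open>The workhorse for what follows: products, bounded quantifiers and the bounded search in
  \<open>beval\<close> are all written as bounded sums.\<close>

lemma recursive_on_sum:
  assumes "recursive_on (Suc k) F" "recursive_on k N"
  shows "recursive_on k (\<lambda>xs. \<Sum>l<N xs. F (l # xs))"
proof -
  have eq: "rec_nat 0 (\<lambda>m r. r + h m) n = (\<Sum>l<n. h l)" for n and h :: "nat \<Rightarrow> nat"
    by (induction n) auto
  have "recursive_on (2 + k) (\<lambda>ys. ys ! 1 + F (ys ! 0 # drop 2 ys))"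
    by (intro recursive_on_add recursive_on_nth recursive_on_comp[OF assms(1)]
          recursive_vec_Cons recursive_vec_drop) auto
  hence "recursive_on (Suc (Suc k)) (\<lambda>ys. ys ! 1 + F (ys ! 0 # drop 2 ys))" by simp
  from recursive_on_rec_nat[OF recursive_on_const[of k 0] this assms(2)] show ?thesis
    by (simp add: eq)
qed

lemma recursive_on_mult:
  assumes "recursive_on k F" "recursive_on k G"
  shows "recursive_on k (\<lambda>xs. F xs * G xs)"
  \<comment> \<open>The product is a sum of \<open>F xs\<close> equal terms; \<open>drop 1\<close>
    makes the summand ignore the summation index.\<close>
  using recursive_on_sum[of k "\<lambda>ys. G (drop 1 ys)" F] recursive_on_drop[OF assms(2), of 1] assms(1)
  by simp

lemma decidable_on_pos:
  assumes "recursive_on k F" shows "decidable_on k (\<lambda>xs. 0 < F xs)"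
proof -
  have eq: "rec_nat 0 (\<lambda>m r. Suc 0) n = of_bool (0 < n)" for n :: nat
    by (cases n) auto
  show ?thesis
    using recursive_on_rec_nat[OF recursive_on_const[of k 0] recursive_on_const[of _ "Suc 0"] assms]
    by (simp add: eq)
qed

lemma decidable_on_less:
  assumes "recursive_on k F" "recursive_on k G"
  shows "decidable_on k (\<lambda>xs. F xs < G xs)"
  using decidable_on_pos[OF recursive_on_diff[OF assms(2,1)]] by simp

lemma decidable_on_not:
  assumes "decidable_on k P" shows "decidable_on k (\<lambda>xs. \<not> P xs)"
  by (rule recursive_on_cong[OF recursive_on_diff[OF recursive_on_const[of k 1] assms]]) auto

lemma decidable_on_conj:
  assumes "decidable_on k P" "decidable_on k Q"
  shows "decidable_on k (\<lambda>xs. P xs \<and> Q xs)"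
  by (rule recursive_on_cong[OF recursive_on_mult[OF assms]]) auto

text \<open>The sum of the characteristic values counts the witnesses below the bound, so the
  quantifier holds iff this sum is positive.\<close>

lemma decidable_on_bex:
  assumes "decidable_on (Suc k) P" "recursive_on k N"
  shows "decidable_on k (\<lambda>xs. \<exists>l<N xs. P (l # xs))"
proof (rule recursive_on_cong[OF decidable_on_pos[OF recursive_on_sum[OF assms]]])
  fix xs
  have "(\<Sum>l<N xs. of_bool (P (l # xs)) :: nat) = 0 \<longleftrightarrow> (\<forall>l<N xs. \<not> P (l # xs))"
    by (subst sum_eq_0_iff) auto
  hence "0 < (\<Sum>l<N xs. of_bool (P (l # xs)) :: nat) \<longleftrightarrow> (\<exists>l<N xs. P (l # xs))"
    by (metis gr0I less_irrefl)
  thus "of_bool (0 < (\<Sum>l<N xs. of_bool (P (l # xs)) :: nat)) = (of_bool (\<exists>l<N xs. P (l # xs)) :: nat)"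
    by (rule arg_cong)
qed

lemma decidable_on_ball:
  assumes "decidable_on (Suc k) P" "recursive_on k N"
  shows "decidable_on k (\<lambda>xs. \<forall>l<N xs. P (l # xs))"
  using decidable_on_not[OF decidable_on_bex[OF decidable_on_not[OF assms(1)] assms(2)]] by simp

lemma recursive_on_if:
  assumes "decidable_on k P" "recursive_on k F" "recursive_on k G"
  shows "recursive_on k (\<lambda>xs. if P xs then F xs else G xs)"
  by (rule recursive_on_cong[OF recursive_on_add[OF recursive_on_mult[OF assms(1,2)]
        recursive_on_mult[OF decidable_on_not[OF assms(1)] assms(3)]]]) auto

section \<open>Stage-bounded evaluation of partial recursive functions\<close>

text \<open>Evaluation with resource bound \<open>s\<close>: the result is \<open>0\<close> if no value has been found,
  and \<open>Suc y\<close> if the value is \<open>y\<close>.\<close>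
fun beval :: "recf \<Rightarrow> nat \<Rightarrow> nat list \<Rightarrow> nat" where
  "beval Zr s xs = 1"
| "beval Sc s xs = (if xs = [] then 0 else Suc (Suc (hd xs)))"
| "beval (Proj i) s xs = (if i < length xs then Suc (xs ! i) else 0)"
| "beval (Comp f gs) s xs =
     (if \<exists>g\<in>set gs. beval g s xs = 0 then 0 else beval f s (map (\<lambda>g. beval g s xs - 1) gs))"
| "beval (Prim f g) s xs =
     (if xs = [] then 0
      else rec_nat (beval f s (tl xs))
             (\<lambda>m r. if r = 0 then 0 else beval g s (m # (r - 1) # tl xs)) (hd xs))"
| "beval (Mn f) s xs =
     (\<Sum>n<s. if beval f s (n # xs) = 1 \<and> (\<forall>m<n. 1 < beval f s (m # xs)) then Suc n else 0)"

lemma beval_Prim_0: "beval (Prim f g) s (0 # zs) = beval f s zs"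
  by simp

lemma beval_Prim_Suc:
  "beval (Prim f g) s (Suc n # zs) =
     (if beval (Prim f g) s (n # zs) = 0 then 0
      else beval g s (n # (beval (Prim f g) s (n # zs) - 1) # zs))"
  unfolding beval.simps list.sel by simp

text \<open>The sum in \<open>beval\<close> has at most one nonzero term: of two candidates, the
  smaller would have to give value 0 and also a positive value. Hence the sum is the result of the
  search.\<close>

lemma beval_Mn_eq_Suc_iff:
  "beval (Mn f) s xs = Suc n \<longleftrightarrow>
     n < s \<and> beval f s (n # xs) = 1 \<and> (\<forall>m<n. 1 < beval f s (m # xs))"
proof -
  define Q where "Q n \<longleftrightarrow> beval f s (n # xs) = 1 \<and> (\<forall>m<n. 1 < beval f s (m # xs))" for n
  have beval_eq: "beval (Mn f) s xs = (\<Sum>n<s. if Q n then Suc n else 0)"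
    by (simp only: beval.simps Q_def)
  have uniq: "a = b" if "Q a" "Q b" for a b
    using that unfolding Q_def by (metis less_irrefl linorder_neqE_nat)
  have val: "beval (Mn f) s xs = Suc a" if "a < s" "Q a" for a
  proof -
    have "Q n \<longleftrightarrow> n = a" for n using uniq that(2) by blast
    thus ?thesis using that(1) by (simp add: beval_eq del: beval.simps)
  qed
  have "\<exists>a<s. Q a" if "beval (Mn f) s xs = Suc n"
  proof (rule ccontr)
    assume "\<not> (\<exists>a<s. Q a)"
    hence "(\<Sum>n<s. if Q n then Suc n else 0) = 0" by (intro sum.neutral) auto
    thus False using that beval_eq by simp
  qed
  hence "beval (Mn f) s xs = Suc n \<longleftrightarrow> n < s \<and> Q n"
    using val by (metis nat.inject)
  thus ?thesis by (simp only: Q_def)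
qed

text \<open>The bound acts only as the length of the search in \<open>Mn\<close>. A successful
  search rests on inner evaluations that have already returned values; these persist, and a longer
  search finds the same least zero.\<close>

lemma beval_mono: "beval f s xs = Suc y \<Longrightarrow> s \<le> t \<Longrightarrow> beval f t xs = Suc y"
proof (induction f arbitrary: xs y)
  case (Comp f gs)
  have pos: "0 < beval g s xs" if "g \<in> set gs" for g
    using Comp.prems(1) that by (auto split: if_splits)
  hence eq: "beval g t xs = beval g s xs" if "g \<in> set gs" for g
    using Comp.IH(2)[OF that _ Comp.prems(2), of xs "beval g s xs - 1"] pos[OF that] by simp
  have "beval f s (map (\<lambda>g. beval g s xs - 1) gs) = Suc y"
    using Comp.prems(1) by (auto split: if_splits)
  hence "beval f t (map (\<lambda>g. beval g s xs - 1) gs) = Suc y"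
    by (rule Comp.IH(1)[OF _ Comp.prems(2)])
  moreover have "map (\<lambda>g. beval g t xs - 1) gs = map (\<lambda>g. beval g s xs - 1) gs"
    using eq by (intro map_cong) auto
  moreover have "\<not> (\<exists>g\<in>set gs. beval g t xs = 0)"
    using pos eq by force
  ultimately show ?case unfolding beval.simps by (simp only: if_False)
next
  case (Prim f g)
  then obtain n zs where xs: "xs = n # zs" by (cases xs) auto
  have "beval (Prim f g) s (n # zs) = Suc y \<Longrightarrow> beval (Prim f g) t (n # zs) = Suc y" for y
  proof (induction n arbitrary: y)
    case 0
    thus ?case using Prim.IH(1)[OF _ Prim.prems(2)] unfolding beval_Prim_0 by blast
  next
    case (Suc n)
    show ?case
    proof (cases "beval (Prim f g) s (n # zs)")
      case 0
      thus ?thesis using Suc.prems by (simp add: beval_Prim_Suc del: beval.simps)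
    next
      case (Suc r)
      with Suc.IH have "beval (Prim f g) t (n # zs) = Suc r" by blast
      moreover have "beval g s (n # r # zs) = Suc y"
        using Suc Suc.prems by (simp add: beval_Prim_Suc del: beval.simps)
      hence "beval g t (n # r # zs) = Suc y"
        by (rule Prim.IH(2)[OF _ Prim.prems(2)])
      ultimately show ?thesis by (simp add: beval_Prim_Suc del: beval.simps)
    qed
  qed
  thus ?case using Prim.prems(1) xs by blast
next
  case (Mn f)
  from Mn.prems(1) have *: "y < s" "beval f s (y # xs) = 1" "\<And>m. m < y \<Longrightarrow> 1 < beval f s (m # xs)"
    unfolding beval_Mn_eq_Suc_iff by auto
  have "beval f t (m # xs) = beval f s (m # xs)" if "m < y" for m
    using Mn.IH[of "m # xs" "beval f s (m # xs) - 1"] *(3)[OF that] Mn.prems(2) by simp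
  moreover have "beval f t (y # xs) = Suc 0"
    using *(2) by (intro Mn.IH[OF _ Mn.prems(2)]) simp
  ultimately show ?case using * Mn.prems(2) unfolding beval_Mn_eq_Suc_iff by simp
qed auto

lemma reval_if_beval: "beval f s xs = Suc y \<Longrightarrow> reval f xs y"
proof (induction f arbitrary: xs y)
  case (Comp f gs)
  have pos: "0 < beval g s xs" if "g \<in> set gs" for g
    using Comp.prems(1) that by (auto split: if_splits)
  have "beval f s (map (\<lambda>g. beval g s xs - 1) gs) = Suc y"
    using Comp.prems(1) by (auto split: if_splits)
  moreover have "reval g xs (beval g s xs - 1)" if "g \<in> set gs" for g
    using Comp.IH(2)[OF that] pos[OF that] by simp
  ultimately show ?case
    by (intro reval_Comp[of "map (\<lambda>g. beval g s xs - 1) gs"] Comp.IH(1)) auto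
next
  case (Prim f g)
  then obtain n zs where xs: "xs = n # zs" by (cases xs) auto
  have "beval (Prim f g) s (n # zs) = Suc y \<Longrightarrow> reval (Prim f g) (n # zs) y" for y
  proof (induction n arbitrary: y)
    case 0
    thus ?case using Prim.IH(1) unfolding beval_Prim_0 by (blast intro: reval_Prim0)
  next
    case (Suc n)
    show ?case
    proof (cases "beval (Prim f g) s (n # zs)")
      case 0
      thus ?thesis using Suc.prems by (simp add: beval_Prim_Suc del: beval.simps)
    next
      case (Suc r)
      hence "beval g s (n # r # zs) = Suc y"
        using Suc.prems by (simp add: beval_Prim_Suc del: beval.simps)
      thus ?thesis using Suc.IH[OF Suc] Prim.IH(2) by (blast intro: reval_PrimS)
    qed
  qed
  thus ?case using Prim.prems(1) xs by blast
next
  case (Mn f)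
  from Mn.prems have *: "beval f s (y # xs) = Suc 0" "\<And>m. m < y \<Longrightarrow> 1 < beval f s (m # xs)"
    unfolding beval_Mn_eq_Suc_iff by auto
  have "\<exists>r. reval f (m # xs) r \<and> 0 < r" if "m < y" for m
    using Mn.IH[of "m # xs" "beval f s (m # xs) - 1"] *(2)[OF that]
    by (intro exI[of _ "beval f s (m # xs) - 1"]) auto
  thus ?case using Mn.IH[OF *(1)] by (intro reval_Mn) auto
next
  case (Sc xs)
  thus ?case by (cases xs) (auto intro: reval_S)
qed (auto intro: reval_Z reval_Proj split: if_splits)

text \<open>Merges finitely many persistent stages into one, as the components of
  \<open>Comp\<close> and the smaller arguments in \<open>Mn\<close> require.\<close>

lemma finite_stage_bound:
  fixes n :: nat
  assumes "\<forall>i<n. \<exists>s. P i s" "\<And>i s t. P i s \<Longrightarrow> s \<le> t \<Longrightarrow> P i t"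
  shows "\<exists>s::nat. \<forall>i<n. P i s"
  using assms(1)
proof (induction n)
  case (Suc n)
  then obtain s t where "\<forall>i<n. P i s" "P n t" by auto
  hence "\<forall>i<Suc n. P i (max s t)"
    using assms(2) by (auto simp: less_Suc_eq intro: max.cobounded1 max.cobounded2)
  thus ?case by blast
qed simp

text \<open>A derivation of \<open>reval\<close> uses finitely many evaluations at each rule. Each
  succeeds at some stage, and by \<open>beval_mono\<close> all succeed at the maximum of these
  stages.\<close>

lemma beval_if_reval: "reval f xs y \<Longrightarrow> \<exists>s. beval f s xs = Suc y"
proof (induction rule: reval.induct)
  case (reval_Comp ys gs xs f z)
  have "\<exists>s. \<forall>i<length gs. beval (gs ! i) s xs = Suc (ys ! i)"
    by (rule finite_stage_bound) (use reval_Comp in \<open>auto intro: beval_mono\<close>)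
  then obtain s where s: "\<forall>i<length gs. beval (gs ! i) s xs = Suc (ys ! i)" ..
  obtain t where t: "beval f t ys = Suc z" using reval_Comp by blast
  define u where "u = max s t"
  have u: "beval (gs ! i) u xs = Suc (ys ! i)" if "i < length gs" for i
    using s that beval_mono[of _ s _ _ u] by (auto simp: u_def)
  have "map (\<lambda>g. beval g u xs - 1) gs = ys"
    using u reval_Comp.hyps(1) by (auto intro!: nth_equalityI)
  moreover have "beval f u ys = Suc z" using t beval_mono[of _ t _ _ u] by (auto simp: u_def)
  ultimately have "beval (Comp f gs) u xs = Suc z"
    using u by (metis beval.simps(4) in_set_conv_nth nat.distinct(1))
  thus ?case ..
next
  case (reval_PrimS f g n xs y z)
  then obtain s t where st: "beval (Prim f g) s (n # xs) = Suc y" "beval g t (n # y # xs) = Suc z"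
    by blast
  have "beval (Prim f g) (max s t) (n # xs) = Suc y" "beval g (max s t) (n # y # xs) = Suc z"
    using st beval_mono max.cobounded1 max.cobounded2 by blast+
  hence "beval (Prim f g) (max s t) (Suc n # xs) = Suc z"
    by (simp add: beval_Prim_Suc del: beval.simps)
  thus ?case ..
next
  case (reval_Mn f n xs)
  have "\<exists>s. \<forall>m<n. 1 < beval f s (m # xs)"
  proof (rule finite_stage_bound)
    show "\<forall>m<n. \<exists>s. 1 < beval f s (m # xs)" using reval_Mn.IH(2)
      by (metis One_nat_def Suc_less_eq)
  next
    fix m s t assume "1 < beval f s (m # xs)" "s \<le> t"
    thus "1 < beval f t (m # xs)"
      using beval_mono[of f s "m # xs" "beval f s (m # xs) - 1" t] by simp
  qed
  then obtain s where s: "\<And>m. m < n \<Longrightarrow> 1 < beval f s (m # xs)" by blast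
  obtain t where t: "beval f t (n # xs) = Suc 0" using reval_Mn.IH(1) by blast
  \<comment> \<open>At stage \<open>u\<close> the search runs over arguments below \<open>u\<close>,
    so \<open>u\<close> must exceed \<open>n\<close> itself.\<close>
  define u where "u = max (Suc n) (max s t)"
  have "1 < beval f u (m # xs)" if "m < n" for m
    using s[OF that] beval_mono[of f s "m # xs" "beval f s (m # xs) - 1" u] by (simp add: u_def)
  moreover have "beval f u (n # xs) = 1" using beval_mono[OF t, of u] by (simp add: u_def)
  ultimately have "beval (Mn f) u xs = Suc n"
    unfolding beval_Mn_eq_Suc_iff by (auto simp: u_def)
  thus ?case ..
qed auto

text \<open>Two derivations are compared at a common stage, where \<open>beval\<close> is a
  function.\<close>

lemma reval_deterministic: "reval f xs y \<Longrightarrow> reval f xs z \<Longrightarrow> y = z"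
proof -
  assume "reval f xs y" "reval f xs z"
  then obtain s t where "beval f s xs = Suc y" "beval f t xs = Suc z"
    using beval_if_reval by blast
  hence "beval f (max s t) xs = Suc y" "beval f (max s t) xs = Suc z"
    using beval_mono max.cobounded1 max.cobounded2 by blast+
  thus "y = z" by simp
qed

text \<open>The induction is on the syntax of \<open>f\<close>, so each \<open>f\<close> gets its
  own program, with the stage as its first argument. The arity \<open>k\<close> is generalised
  because \<open>Prim\<close> and \<open>Mn\<close> evaluate their subterms on lists of other
  lengths.\<close>

lemma recursive_on_beval: "recursive_on (Suc k) (\<lambda>ys. beval f (hd ys) (tl ys))"
proof (induction f arbitrary: k)
  case Zr
  show ?case by (simp add: recursive_on_const)
next
  case Sc
  show ?case
  proof (cases k)
    case 0
    show ?thesis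
      by (rule recursive_on_cong[OF recursive_on_const[of _ 0]]) (auto simp: 0 length_Suc_conv)
  next
    case (Suc k')
    show ?thesis
      by (rule recursive_on_cong[OF recursive_on_Suc[OF recursive_on_Suc[OF recursive_on_nth[of 1]]]])
         (auto simp: Suc length_Suc_conv)
  qed
next
  case (Proj i)
  show ?case
  proof (cases "i < k")
    case True
    show ?thesis
      by (rule recursive_on_cong[OF recursive_on_Suc[OF recursive_on_nth[of "Suc i"]]])
         (use True in \<open>auto simp: length_Suc_conv\<close>)
  next
    case False
    show ?thesis
      by (rule recursive_on_cong[OF recursive_on_const[of _ 0]])
         (use False in \<open>auto simp: length_Suc_conv\<close>)
  qed
next
  case (Comp f gs)
  have hd: "recursive_on (Suc k) hd"
    by (rule recursive_on_cong[OF recursive_on_nth[of 0]]) (auto simp: length_Suc_conv)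
  have g: "recursive_on (Suc k) (\<lambda>ys. beval g (hd ys) (tl ys))" if "g \<in> set gs" for g
    using Comp.IH(2) that by blast
  \<comment> \<open>A conjunction of fixed finite length, assembled one component at a time;
    \<open>hs\<close> is kept within \<open>gs\<close> so that the outer induction hypothesis
    applies to its members.\<close>
  have "decidable_on (Suc k) (\<lambda>ys. \<forall>g\<in>set hs. 0 < beval g (hd ys) (tl ys))"
    if "set hs \<subseteq> set gs" for hs
    using that
  proof (induction hs)
    case Nil
    show ?case by (simp add: recursive_on_const)
  next
    case (Cons h hs)
    thus ?case using decidable_on_conj[OF decidable_on_pos[OF g[of h]]] by simp
  qed
  hence dec: "decidable_on (Suc k) (\<lambda>ys. \<forall>g\<in>set gs. 0 < beval g (hd ys) (tl ys))" by blast
  have app: "recursive_on (Suc k)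
      (\<lambda>ys. beval f (hd ys) (map (\<lambda>g. beval g (hd ys) (tl ys) - 1) gs))"
    using recursive_on_comp[OF Comp.IH(1) recursive_vec_Cons[OF hd
        recursive_vec_map[of gs _ "\<lambda>g ys. beval g (hd ys) (tl ys) - 1"]]]
      recursive_on_pred[OF g] by simp
  show ?case
    by (rule recursive_on_cong[OF recursive_on_if[OF dec app recursive_on_const[of _ 0]]]) auto
next
  case (Prim f g)
  show ?case
  proof (cases k)
    case 0
    show ?thesis
      by (rule recursive_on_cong[OF recursive_on_const[of _ 0]]) (auto simp: 0 length_Suc_conv)
  next
    case (Suc j)
    have "recursive_on (2 + j) (\<lambda>ys. beval f (hd (ys ! 0 # drop 2 ys)) (tl (ys ! 0 # drop 2 ys)))"
      by (intro recursive_on_comp[OF Prim.IH(1)[of j]] recursive_vec_Cons recursive_on_nth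
          recursive_vec_drop) auto
    hence F: "recursive_on (2 + j) (\<lambda>ys. beval f (ys ! 0) (drop 2 ys))" by simp
    \<comment> \<open>Inside the recursion the arguments are counter, previous result, stage,
      recursion length, parameters. Thus \<open>ys ! 2\<close> is the stage,
      \<open>ys ! 1 - 1\<close> decodes the previous result, and \<open>drop 4\<close> leaves the
      parameters.\<close>
    let ?v = "\<lambda>ys. ys ! 2 # ys ! 0 # (ys ! 1 - 1) # drop 4 ys"
    have "recursive_on (4 + j) (\<lambda>ys. beval g (hd (?v ys)) (tl (?v ys)))"
      by (intro recursive_on_comp[OF Prim.IH(2)[of "Suc (Suc j)"]] recursive_vec_Cons recursive_on_nth
          recursive_on_pred recursive_vec_drop) auto
    hence "recursive_on (4 + j)
        (\<lambda>ys. if 0 < ys ! 1 then beval g (hd (?v ys)) (tl (?v ys)) else 0)"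
      by (intro recursive_on_if decidable_on_pos recursive_on_nth recursive_on_const) auto
    hence G: "recursive_on (Suc (Suc (2 + j)))
        (\<lambda>ys. if 0 < ys ! 1 then beval g (hd (?v ys)) (tl (?v ys)) else 0)"
      by (simp add: numeral_eq_Suc)
    have "recursive_on (2 + j) (\<lambda>ys. beval (Prim f g) (hd ys) (tl ys))"
      by (rule recursive_on_cong[OF recursive_on_rec_nat[OF F G recursive_on_nth[of 1]]])
         (auto simp: length_Suc_conv numeral_eq_Suc fun_eq_iff
            intro!: arg_cong[of _ _ "\<lambda>h. rec_nat _ h _"])
    thus ?thesis by (simp add: Suc)
  qed
next
  case (Mn f)
  have hd: "recursive_on (Suc k) (\<lambda>xs. xs ! 0)"
    by (rule recursive_on_nth) auto
  \<comment> \<open>Here the arguments are candidate, stage, parameters; in \<open>f2\<close> a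
    smaller argument to be tested is put in front of them.\<close>
  have f1: "recursive_on (2 + k) (\<lambda>ys. beval f (ys ! 1) (ys ! 0 # drop 2 ys))"
  proof -
    have "recursive_vec (2 + k) (Suc (Suc k)) (\<lambda>ys. ys ! 1 # ys ! 0 # drop 2 ys)"
      by (intro recursive_vec_Cons recursive_on_nth recursive_vec_drop) auto
    from recursive_on_comp[OF Mn.IH[of "Suc k"] this] show ?thesis by simp
  qed
  have f2: "recursive_on (3 + k) (\<lambda>ys. beval f (ys ! 2) (ys ! 0 # drop 3 ys))"
  proof -
    have "recursive_vec (3 + k) (Suc (Suc k)) (\<lambda>ys. ys ! 2 # ys ! 0 # drop 3 ys)"
      by (intro recursive_vec_Cons recursive_on_nth recursive_vec_drop) auto
    from recursive_on_comp[OF Mn.IH[of "Suc k"] this] show ?thesis by simp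
  qed
  have "decidable_on (3 + k) (\<lambda>ys. 1 < beval f (ys ! 2) (ys ! 0 # drop 3 ys))"
    by (intro decidable_on_less recursive_on_const f2)
  hence "decidable_on (Suc (2 + k)) (\<lambda>ys. 1 < beval f (ys ! 2) (ys ! 0 # drop 3 ys))"
    by (simp add: numeral_eq_Suc)
  from decidable_on_ball[OF this recursive_on_nth[of 0]]
  have ball: "decidable_on (2 + k) (\<lambda>ys. \<forall>m<ys ! 0. 1 < beval f (ys ! 1) (m # drop 2 ys))"
    by (simp add: numeral_eq_Suc)
  \<comment> \<open>Equality with 1 is expressed as being positive and not greater than 1.\<close>
  have "recursive_on (2 + k) (\<lambda>ys. if (0 < beval f (ys ! 1) (ys ! 0 # drop 2 ys)
          \<and> \<not> 1 < beval f (ys ! 1) (ys ! 0 # drop 2 ys))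
        \<and> (\<forall>m<ys ! 0. 1 < beval f (ys ! 1) (m # drop 2 ys)) then Suc (ys ! 0) else 0)"
    by (intro recursive_on_if decidable_on_conj decidable_on_not decidable_on_less
        decidable_on_pos f1 ball recursive_on_Suc recursive_on_const recursive_on_nth) auto
  hence "recursive_on (Suc (Suc k)) (\<lambda>ys. if (0 < beval f (ys ! 1) (ys ! 0 # drop 2 ys)
          \<and> \<not> 1 < beval f (ys ! 1) (ys ! 0 # drop 2 ys))
        \<and> (\<forall>m<ys ! 0. 1 < beval f (ys ! 1) (m # drop 2 ys)) then Suc (ys ! 0) else 0)"
    by simp
  from recursive_on_sum[OF this hd] show ?case
  proof (rule recursive_on_cong, goal_cases)
    case (1 ys)
    then obtain s xs where "ys = s # xs" by (cases ys) auto
    thus ?case unfolding beval.simps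
      by (intro sum.cong) (auto simp: numeral_2_eq_2 less_Suc_eq)
  qed
qed

section \<open>Decidable predicates and arithmetic on string codes\<close>

text \<open>Unbounded search over a function that ignores the search variable halts at once if the
  predicate holds and never otherwise. This turns a characteristic function into a domain.\<close>

lemma unif_ce_if_decidable:
  assumes P: "decidable_on 2 P" and V: "\<And>i \<sigma>. \<sigma> \<in> V i \<longleftrightarrow> P [i, str_code \<sigma>]"
  shows "unif_ce V"
proof -
  have "decidable_on (1 + 2) (\<lambda>ys. \<not> P (drop 1 ys))"
    by (rule recursive_on_drop[OF decidable_on_not[OF P]])
  then obtain h where h: "\<And>ys. length ys = 3 \<Longrightarrow> reval h ys (of_bool (\<not> P (drop 1 ys)))"
    unfolding recursive_on_def by (auto simp: numeral_3_eq_3)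
  have "P [i, c] \<longleftrightarrow> (\<exists>y. reval (Mn h) [i, c] y)" for i c
  proof
    assume "P [i, c]"
    hence "reval h [0, i, c] 0" using h[of "[0, i, c]"] by simp
    hence "reval (Mn h) [i, c] 0" by (intro reval_Mn) auto
    thus "\<exists>y. reval (Mn h) [i, c] y" ..
  next
    assume "\<exists>y. reval (Mn h) [i, c] y"
    then obtain y where "reval h [y, i, c] 0" by (auto elim: reval.cases)
    moreover have "reval h [y, i, c] (of_bool (\<not> P [i, c]))" using h[of "[y, i, c]"] by simp
    ultimately have "of_bool (\<not> P [i, c]) = (0::nat)" using reval_deterministic by blast
    thus "P [i, c]" by (cases "P [i, c]") auto
  qed
  thus ?thesis unfolding unif_ce_def using V by blast
qed

text \<open>\<open>str_code\<close> is bijective base 2 with the head as least significant digit. So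
  \<open>(r - 1) div 2\<close> deletes the head, and it fixes 0, the code of the empty
  string.\<close>

definition code_drop :: "nat \<Rightarrow> nat \<Rightarrow> nat" where
  "code_drop l c = rec_nat c (\<lambda>_ r. (r - 1) div 2) l"

definition code_take :: "nat \<Rightarrow> nat \<Rightarrow> nat" where
  "code_take l c = c - 2 ^ l * code_drop l c"

lemma code_drop_str_code: "code_drop l (str_code \<sigma>) = str_code (drop l \<sigma>)"
proof (induction l)
  case (Suc l)
  have "(str_code \<tau> - 1) div 2 = str_code (tl \<tau>)" for \<tau>
    by (cases \<tau>) auto
  with Suc show ?case by (simp add: code_drop_def drop_Suc tl_drop)
qed (simp add: code_drop_def)

text \<open>The positional value splits at digit \<open>l\<close>; this is why the subtraction in
  \<open>code_take\<close> yields the code of the prefix.\<close>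

lemma str_code_take_drop: "str_code (take l \<sigma>) + 2 ^ l * str_code (drop l \<sigma>) = str_code \<sigma>"
proof (induction \<sigma> arbitrary: l)
  case (Cons b \<sigma>)
  show ?case
  proof (cases l)
    case (Suc m)
    thus ?thesis using Cons[of m] by auto
  qed simp
qed simp

lemma code_take_str_code: "code_take l (str_code \<sigma>) = str_code (take l \<sigma>)"
  using str_code_take_drop[of l \<sigma>] by (simp add: code_take_def code_drop_str_code)

lemma str_code_pos_iff: "0 < str_code \<sigma> \<longleftrightarrow> \<sigma> \<noteq> []"
  by (cases \<sigma>) auto

text \<open>Lets the code serve as a bound when searching through all prefixes, and makes the codes
  of longer and longer initial segments exceed any given stage.\<close>

lemma length_le_str_code: "length \<sigma> \<le> str_code \<sigma>"
  by (induction \<sigma>) auto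

lemma recursive_on_div_2:
  assumes "recursive_on k F" shows "recursive_on k (\<lambda>xs. F xs div 2)"
proof -
  \<comment> \<open>Halving by recursion: \<open>Suc m div 2 = m - m div 2\<close>.\<close>
  have eq: "rec_nat 0 (\<lambda>m r. m - r) n = n div 2" for n :: nat
    by (induction n) auto
  have "recursive_on (Suc (Suc k)) (\<lambda>ys. ys ! 0 - ys ! 1)"
    by (intro recursive_on_diff recursive_on_nth) auto
  from recursive_on_rec_nat[OF recursive_on_const[of k 0] this assms] show ?thesis
    by (simp add: eq)
qed

lemma recursive_on_power_2:
  assumes "recursive_on k F" shows "recursive_on k (\<lambda>xs. 2 ^ F xs)"
proof -
  have eq: "rec_nat 1 (\<lambda>m r. r + r) n = (2::nat) ^ n" for n
    by (induction n) auto
  have "recursive_on (Suc (Suc k)) (\<lambda>ys. ys ! 1 + ys ! 1)"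
    by (intro recursive_on_add recursive_on_nth) auto
  from recursive_on_rec_nat[OF recursive_on_const[of k 1] this assms] show ?thesis
    by (simp add: eq[simplified])
qed

lemma recursive_on_code_drop:
  assumes "recursive_on k L" "recursive_on k C"
  shows "recursive_on k (\<lambda>xs. code_drop (L xs) (C xs))"
proof -
  have "recursive_on (Suc (Suc k)) (\<lambda>ys. (ys ! 1 - 1) div 2)"
    by (intro recursive_on_div_2 recursive_on_pred recursive_on_nth) auto
  from recursive_on_rec_nat[OF assms(2) this assms(1)] show ?thesis
    by (simp add: code_drop_def)
qed

lemma recursive_on_code_take:
  assumes "recursive_on k L" "recursive_on k C"
  shows "recursive_on k (\<lambda>xs. code_take (L xs) (C xs))"
  unfolding code_take_def
  by (intro recursive_on_diff recursive_on_mult recursive_on_power_2 recursive_on_code_drop assms)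

section \<open>Antichains of strings\<close>

definition prefix_minimal :: "bool list set \<Rightarrow> bool list set" where
  "prefix_minimal S = {\<sigma> \<in> S. \<forall>l<length \<sigma>. take l \<sigma> \<notin> S}"

definition antichain :: "bool list set \<Rightarrow> bool" where
  "antichain A \<longleftrightarrow> (\<forall>\<sigma>\<in>A. \<forall>\<tau>\<in>A. prefix \<sigma> \<tau> \<longrightarrow> \<sigma> = \<tau>)"

lemma antichain_prefix_minimal: "antichain (prefix_minimal S)"
proof (unfold antichain_def, intro ballI impI)
  fix \<sigma> \<tau> assume "\<sigma> \<in> prefix_minimal S" "\<tau> \<in> prefix_minimal S" "prefix \<sigma> \<tau>"
  moreover from \<open>prefix \<sigma> \<tau>\<close> have "take (length \<sigma>) \<tau> = \<sigma>" by (auto simp: prefix_def)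
  ultimately have "\<not> length \<sigma> < length \<tau>" by (auto simp: prefix_minimal_def)
  with \<open>prefix \<sigma> \<tau>\<close> show "\<sigma> = \<tau>" by (auto simp: prefix_def)
qed

lemma cyl_prefix_mono: "prefix \<sigma> \<tau> \<Longrightarrow> cyl \<tau> \<subseteq> cyl \<sigma>"
  by (auto simp: cyl_def str_prefix_seq_def prefix_def nth_append)

text \<open>Every string of \<open>S\<close> extends its shortest prefix in \<open>S\<close>, which
  is minimal and has the larger cylinder.\<close>

lemma cylset_prefix_minimal: "cylset (prefix_minimal S) = cylset S"
proof
  show "cylset (prefix_minimal S) \<subseteq> cylset S"
    by (auto simp: cylset_def prefix_minimal_def)
  have "\<exists>\<tau>\<in>prefix_minimal S. prefix \<tau> \<sigma>" if "\<sigma> \<in> S" for \<sigma>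
  proof -
    define l where "l = (LEAST l. take l \<sigma> \<in> S)"
    have "take l \<sigma> \<in> S"
      unfolding l_def by (rule LeastI[of _ "length \<sigma>"]) (use that in simp)
    moreover have "take m \<sigma> \<notin> S" if "m < l" for m
      using not_less_Least that unfolding l_def by blast
    ultimately have "take l \<sigma> \<in> prefix_minimal S"
      by (auto simp: prefix_minimal_def min_def)
    thus ?thesis using take_is_prefix by blast
  qed
  thus "cylset S \<subseteq> cylset (prefix_minimal S)"
    using cyl_prefix_mono unfolding cylset_def by blast
qed

text \<open>Two strings whose cylinders share a point \<open>X\<close> are both initial segments of
  \<open>X\<close>, hence comparable.\<close>

lemma disjoint_cyl:
  assumes "antichain A" shows "disjoint_family_on cyl A"
proof (unfold disjoint_family_on_def, intro ballI impI)
  fix \<sigma> \<tau> assume *: "\<sigma> \<in> A" "\<tau> \<in> A" "\<sigma> \<noteq> \<tau>"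
  show "cyl \<sigma> \<inter> cyl \<tau> = {}"
  proof (rule ccontr)
    assume "cyl \<sigma> \<inter> cyl \<tau> \<noteq> {}"
    then obtain X where X: "X \<in> cyl \<sigma>" "X \<in> cyl \<tau>" by auto
    have "take n \<mu> = map X [0..<n]" if "X \<in> cyl \<mu>" "n \<le> length \<mu>" for n \<mu>
      using that by (intro nth_equalityI) (auto simp: cyl_def str_prefix_seq_def)
    with X have eq: "take n \<sigma> = take n \<tau>" if "n \<le> length \<sigma>" "n \<le> length \<tau>" for n
      using that by simp
    have "prefix \<sigma> \<tau> \<or> prefix \<tau> \<sigma>"
    proof (cases "length \<sigma> \<le> length \<tau>")
      case True
      thus ?thesis using eq[of "length \<sigma>"] take_is_prefix[of "length \<sigma>" \<tau>] by simp
    next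
      case False
      thus ?thesis using eq[of "length \<tau>"] take_is_prefix[of "length \<tau>" \<sigma>] by simp
    qed
    thus False using assms * unfolding antichain_def by blast
  qed
qed

text \<open>Strings are enumerated late: a long string \<open>\<sigma>\<close> enters only once a prefix of it has been
  enumerated within \<open>str_code \<sigma>\<close> steps. This makes membership decidable, so that the prefix-minimal
  elements are again uniformly c.e.\<close>
lemma unif_ce_antichain_presentation:
  assumes "unif_ce W"
  obtains V where "unif_ce V" "\<And>i. antichain (V i)" "\<And>i \<sigma>. \<sigma> \<in> V i \<Longrightarrow> i < length \<sigma>"
    "\<And>i. cylset (V i) = cylset (W i)"
proof -
  obtain f where f: "\<And>i \<sigma>. \<sigma> \<in> W i \<longleftrightarrow> (\<exists>y. reval f [i, str_code \<sigma>] y)"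
    using assms unfolding unif_ce_def by blast
  \<comment> \<open>The first conjunct says that the string coded by \<open>c\<close> is longer than
    \<open>i\<close>. The second uses \<open>c\<close> both as the stage and as the bound on the
    length of the prefix.\<close>
  define R where "R i c \<longleftrightarrow> 0 < code_drop i c \<and> (\<exists>l<Suc c. 0 < beval f c [i, code_take l c])" for i c
  define S where "S i = {\<sigma>. R i (str_code \<sigma>)}" for i
  define V where "V i = prefix_minimal (S i)" for i
  have beval: "recursive_on k (\<lambda>xs. beval f (s xs) [a xs, b xs])"
    if "recursive_on k s" "recursive_on k a" "recursive_on k b" for k s a b
    using recursive_on_comp[OF recursive_on_beval[of 2 f], of k "\<lambda>xs. [s xs, a xs, b xs]"]
      recursive_vec_Cons[OF that(1) recursive_vec_Cons[OF that(2)
          recursive_vec_Cons[OF that(3) recursive_vec_Nil]]] by (simp add: numeral_eq_Suc)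
  have R: "decidable_on k (\<lambda>xs. R (a xs) (b xs))"
    if "recursive_on k a" "recursive_on k b" for k a b
  proof -
    have "decidable_on 3 (\<lambda>zs. 0 < beval f (zs ! 2) [zs ! 1, code_take (zs ! 0) (zs ! 2)])"
      by (intro decidable_on_pos beval recursive_on_code_take recursive_on_nth) auto
    hence "decidable_on (Suc 2) (\<lambda>zs. 0 < beval f (zs ! 2) [zs ! 1, code_take (zs ! 0) (zs ! 2)])"
      by simp
    from decidable_on_bex[OF this recursive_on_Suc[OF recursive_on_nth[of 1]]]
    have ex: "decidable_on 2
        (\<lambda>ys. \<exists>l<Suc (ys ! 1). 0 < beval f (ys ! 1) [ys ! 0, code_take l (ys ! 1)])"
      by (simp add: numeral_2_eq_2)
    have "decidable_on 2 (\<lambda>ys. R (ys ! 0) (ys ! 1))"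
      unfolding R_def
      by (intro decidable_on_conj ex decidable_on_pos recursive_on_code_drop recursive_on_nth) auto
    from recursive_on_comp[OF this, of k "\<lambda>xs. [a xs, b xs]"] show ?thesis
      using recursive_vec_Cons[OF that(1) recursive_vec_Cons[OF that(2) recursive_vec_Nil]]
      by (simp add: numeral_2_eq_2)
  qed
  have "decidable_on 3 (\<lambda>zs. 0 < code_drop (zs ! 0) (zs ! 2) \<and> R (zs ! 1) (code_take (zs ! 0) (zs ! 2)))"
    by (intro decidable_on_conj decidable_on_pos R recursive_on_code_drop recursive_on_code_take
        recursive_on_nth) auto
  hence "decidable_on (Suc 2)
      (\<lambda>zs. 0 < code_drop (zs ! 0) (zs ! 2) \<and> R (zs ! 1) (code_take (zs ! 0) (zs ! 2)))"
    by simp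
  from decidable_on_bex[OF this recursive_on_nth[of 1]]
  have "decidable_on 2
      (\<lambda>ys. \<exists>l<ys ! 1. 0 < code_drop l (ys ! 1) \<and> R (ys ! 0) (code_take l (ys ! 1)))"
    by (simp add: numeral_2_eq_2)
  hence dec: "decidable_on 2 (\<lambda>ys. R (ys ! 0) (ys ! 1) \<and>
      \<not> (\<exists>l<ys ! 1. 0 < code_drop l (ys ! 1) \<and> R (ys ! 0) (code_take l (ys ! 1))))"
    by (intro decidable_on_conj R decidable_on_not recursive_on_nth) auto
  have "unif_ce V"
  proof (rule unif_ce_if_decidable[OF dec])
    fix i \<sigma>
    \<comment> \<open>On codes, \<open>l < length \<sigma>\<close> reads
      \<open>0 < code_drop l (str_code \<sigma>)\<close>; the bound \<open>str_code \<sigma>\<close>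
      loses no \<open>l\<close> by \<open>length_le_str_code\<close>.\<close>
    have "(\<forall>l<length \<sigma>. take l \<sigma> \<notin> S i) \<longleftrightarrow>
        \<not> (\<exists>l<str_code \<sigma>. 0 < code_drop l (str_code \<sigma>) \<and> R i (code_take l (str_code \<sigma>)))"
      using less_le_trans[OF _ length_le_str_code[of \<sigma>]]
      by (auto simp: S_def code_drop_str_code code_take_str_code str_code_pos_iff not_le)
    thus "\<sigma> \<in> V i \<longleftrightarrow> R ([i, str_code \<sigma>] ! 0) ([i, str_code \<sigma>] ! 1) \<and>
        \<not> (\<exists>l<[i, str_code \<sigma>] ! 1. 0 < code_drop l ([i, str_code \<sigma>] ! 1) \<and>
            R ([i, str_code \<sigma>] ! 0) (code_take l ([i, str_code \<sigma>] ! 1)))"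
      by (auto simp: V_def prefix_minimal_def S_def)
  qed
  moreover have S_iff: "\<sigma> \<in> S i \<longleftrightarrow>
      i < length \<sigma> \<and> (\<exists>l\<le>str_code \<sigma>. 0 < beval f (str_code \<sigma>) [i, str_code (take l \<sigma>)])" for i \<sigma>
    by (auto simp: S_def R_def code_drop_str_code code_take_str_code str_code_pos_iff less_Suc_eq_le)
  have "cylset (S i) = cylset (W i)" for i
  proof
    have "\<exists>\<tau>\<in>W i. prefix \<tau> \<sigma>" if \<sigma>: "\<sigma> \<in> S i" for \<sigma>
    proof -
      obtain l where "0 < beval f (str_code \<sigma>) [i, str_code (take l \<sigma>)]"
        using \<sigma> unfolding S_iff by blast
      hence "take l \<sigma> \<in> W i" unfolding f by (metis gr0_implies_Suc reval_if_beval)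
      thus ?thesis using take_is_prefix by blast
    qed
    thus "cylset (S i) \<subseteq> cylset (W i)"
      using cyl_prefix_mono unfolding cylset_def by blast
  next
    show "cylset (W i) \<subseteq> cylset (S i)"
    proof
      fix X assume "X \<in> cylset (W i)"
      then obtain \<tau> where \<tau>: "\<tau> \<in> W i" "X \<in> cyl \<tau>" unfolding cylset_def by blast
      then obtain y s where s: "beval f s [i, str_code \<tau>] = Suc y"
        unfolding f using beval_if_reval by blast
      \<comment> \<open>An initial segment of \<open>X\<close> long enough to be longer than
        \<open>i\<close>, to extend \<open>\<tau>\<close>, and to have a code of at least
        \<open>s\<close>.\<close>
      define \<sigma> where "\<sigma> = map X [0..<Suc (i + s + length \<tau>)]"
      have len: "length \<sigma> = Suc (i + s + length \<tau>)" by (simp add: \<sigma>_def)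
      have le: "s \<le> str_code \<sigma>" "length \<tau> \<le> str_code \<sigma>"
        using length_le_str_code[of \<sigma>] len by auto
      have "take (length \<tau>) \<sigma> = \<tau>"
        using \<tau>(2) by (intro nth_equalityI) (auto simp: \<sigma>_def cyl_def str_prefix_seq_def simp del: upt_Suc)
      moreover have "beval f (str_code \<sigma>) [i, str_code \<tau>] = Suc y"
        using beval_mono[OF s le(1)] .
      ultimately have "\<sigma> \<in> S i" unfolding S_iff using len le(2) by auto
      moreover have "X \<in> cyl \<sigma>"
        by (auto simp: cyl_def str_prefix_seq_def \<sigma>_def simp del: upt_Suc)
      ultimately show "X \<in> cylset (S i)" unfolding cylset_def by blast
    qed
  qed
  moreover have "i < length \<sigma>" if "\<sigma> \<in> V i" for i \<sigma>
    using that S_iff by (auto simp: V_def prefix_minimal_def)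
  ultimately show ?thesis
    using that[of V] by (simp add: V_def antichain_prefix_minimal cylset_prefix_minimal)
qed

section \<open>Semimeasures and the measure induced by their level limits\<close>

text \<open>Stated for arbitrary functions because it is applied to \<open>\<rho>\<close>, to
  \<open>rho_bar \<rho>\<close> and to their difference.\<close>

definition level_sum :: "(bool list \<Rightarrow> real) \<Rightarrow> bool list \<Rightarrow> nat \<Rightarrow> real" where
  "level_sum \<rho> \<sigma> n = (\<Sum>\<tau>\<in>{\<tau>. length \<tau> = n \<and> prefix \<sigma> \<tau>}. \<rho> \<tau>)"

lemma finite_level: "finite {\<tau> :: bool list. length \<tau> = n \<and> P \<tau>}"
  by (rule finite_subset[OF _ finite_lists_length_eq[of UNIV n]]) auto

lemma prefix_iff_children:
  fixes \<sigma> \<tau> :: "bool list"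
  shows "prefix \<sigma> \<tau> \<longleftrightarrow> \<tau> = \<sigma> \<or> prefix (\<sigma> @ [False]) \<tau> \<or> prefix (\<sigma> @ [True]) \<tau>"
proof
  assume "prefix \<sigma> \<tau>"
  then obtain \<mu> where \<mu>: "\<tau> = \<sigma> @ \<mu>" by (auto simp: prefix_def)
  show "\<tau> = \<sigma> \<or> prefix (\<sigma> @ [False]) \<tau> \<or> prefix (\<sigma> @ [True]) \<tau>"
    by (cases \<mu>; cases "hd \<mu>") (auto simp: \<mu>)
qed (auto simp: prefix_def)

lemma not_prefix_both_children: "prefix (\<sigma> @ [False]) \<tau> \<Longrightarrow> \<not> prefix (\<sigma> @ [True]) \<tau>"
  by (auto simp: prefix_def)

lemma level_sum_self: "level_sum \<rho> \<sigma> (length \<sigma>) = \<rho> \<sigma>"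
proof -
  have "{\<tau>. length \<tau> = length \<sigma> \<and> prefix \<sigma> \<tau>} = {\<sigma>}" by (auto simp: prefix_def)
  thus ?thesis by (simp add: level_sum_def)
qed

lemma level_sum_children:
  assumes "length \<sigma> < n"
  shows "level_sum \<rho> \<sigma> n = level_sum \<rho> (\<sigma> @ [False]) n + level_sum \<rho> (\<sigma> @ [True]) n"
proof -
  have "{\<tau>. length \<tau> = n \<and> prefix \<sigma> \<tau>} =
      {\<tau>. length \<tau> = n \<and> prefix (\<sigma> @ [False]) \<tau>} \<union> {\<tau>. length \<tau> = n \<and> prefix (\<sigma> @ [True]) \<tau>}"
    using assms prefix_iff_children[of \<sigma>] by auto
  thus ?thesis unfolding level_sum_def
    by (simp add: sum.union_disjoint finite_level disjoint_iff not_prefix_both_children)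
qed

text \<open>Level \<open>Suc n\<close> is regrouped by parents, so that superadditivity or
  additivity can be applied termwise on level \<open>n\<close>.\<close>

lemma level_sum_Suc:
  assumes "length \<sigma> \<le> n"
  shows "level_sum \<rho> \<sigma> (Suc n) = level_sum (\<lambda>\<tau>. \<rho> (\<tau> @ [False]) + \<rho> (\<tau> @ [True])) \<sigma> n"
proof -
  let ?L = "{\<tau>. length \<tau> = n \<and> prefix \<sigma> \<tau>}"
  have "{\<tau>. length \<tau> = Suc n \<and> prefix \<sigma> \<tau>} = (\<lambda>\<tau>. \<tau> @ [False]) ` ?L \<union> (\<lambda>\<tau>. \<tau> @ [True]) ` ?L"
    (is "?A = ?B")
  proof
    show "?B \<subseteq> ?A" by auto
    show "?A \<subseteq> ?B"
    proof
      fix \<tau> assume \<tau>: "\<tau> \<in> ?A"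
      then obtain \<mu> b where \<mu>: "\<tau> = \<mu> @ [b]" by (cases \<tau> rule: rev_cases) auto
      with \<tau> assms have "\<mu> \<in> ?L" by auto
      thus "\<tau> \<in> ?B" unfolding \<mu> by (cases b) auto
    qed
  qed
  moreover have "inj_on (\<lambda>\<tau>. \<tau> @ [b]) ?L" for b :: bool by (auto intro: inj_onI)
  moreover have "(\<lambda>\<tau>. \<tau> @ [False]) ` ?L \<inter> (\<lambda>\<tau>. \<tau> @ [True]) ` ?L = {}" by auto
  ultimately show ?thesis unfolding level_sum_def
    by (simp add: sum.union_disjoint finite_level sum.reindex sum.distrib)
qed

text \<open>If \<open>\<sigma>\<close> is in the antichain, it is the only member above itself;
  otherwise the members above it split between its two children. The cutoff \<open>N\<close> keeps
  the sums finite.\<close>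

lemma antichain_sum_le:
  assumes "antichain A" and nonneg: "\<And>\<sigma>. 0 \<le> \<delta> \<sigma>"
    and super: "\<And>\<sigma>. \<delta> (\<sigma> @ [False]) + \<delta> (\<sigma> @ [True]) \<le> (\<delta> \<sigma> :: real)"
  shows "(\<Sum>\<tau>\<in>{\<tau>\<in>A. length \<tau> \<le> N \<and> prefix \<sigma> \<tau>}. \<delta> \<tau>) \<le> \<delta> \<sigma>"
\<comment> \<open>The induction is on the number of levels up to the cutoff; at 0 the string is
  longer than \<open>N\<close> and the sum is empty.\<close>
proof (induction "Suc N - length \<sigma>" arbitrary: \<sigma>)
  case 0
  hence "{\<tau>\<in>A. length \<tau> \<le> N \<and> prefix \<sigma> \<tau>} = {}" by (auto dest: prefix_length_le)
  thus ?case by (simp only: sum.empty nonneg)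
next
  case (Suc k)
  let ?E = "\<lambda>\<sigma>. {\<tau>\<in>A. length \<tau> \<le> N \<and> prefix \<sigma> \<tau>}"
  have fin: "finite (?E \<sigma>)" for \<sigma>
    by (rule finite_subset[OF _ finite_lists_length_le[of "UNIV :: bool set" N]]) auto
  show ?case
  proof (cases "\<sigma> \<in> A")
    case True
    hence "?E \<sigma> = {\<sigma>}" using Suc(2) assms(1) unfolding antichain_def by auto
    thus ?thesis by simp
  next
    case False
    hence "?E \<sigma> = ?E (\<sigma> @ [False]) \<union> ?E (\<sigma> @ [True])"
      using prefix_iff_children[of \<sigma>] by auto
    hence "sum \<delta> (?E \<sigma>) = sum \<delta> (?E (\<sigma> @ [False])) + sum \<delta> (?E (\<sigma> @ [True]))"
      using fin[of "\<sigma> @ [False]"] fin[of "\<sigma> @ [True]"]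
      by (simp add: sum.union_disjoint disjoint_iff not_prefix_both_children)
    also have "\<dots> \<le> \<delta> (\<sigma> @ [False]) + \<delta> (\<sigma> @ [True])"
      by (intro add_mono Suc(1)) (use Suc(2) in auto)
    also have "\<dots> \<le> \<delta> \<sigma>" by (rule super)
    finally show ?thesis .
  qed
qed

text \<open>Monotone convergence reduces the claim to the finite truncations \<open>B N\<close>.
  These are grouped by prefixes of length \<open>n\<close>, and each group is bounded by the value
  of \<open>\<delta>\<close> at its prefix.\<close>

lemma nn_integral_antichain_le:
  assumes "antichain A" and len: "\<And>\<sigma>. \<sigma> \<in> A \<Longrightarrow> n \<le> length \<sigma>" and nonneg: "\<And>\<sigma>. 0 \<le> \<delta> \<sigma>"
    and super: "\<And>\<sigma>. \<delta> (\<sigma> @ [False]) + \<delta> (\<sigma> @ [True]) \<le> (\<delta> \<sigma> :: real)"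
  shows "(\<integral>\<^sup>+\<sigma>. ennreal (\<delta> \<sigma>) \<partial>count_space A) \<le> ennreal (level_sum \<delta> [] n)"
proof -
  define B where "B N = {\<tau>\<in>A. length \<tau> \<le> N}" for N
  have fin: "finite (B N)" for N
    unfolding B_def
    by (rule finite_subset[OF _ finite_lists_length_le[of "UNIV :: bool set" N]]) auto
  have "(\<integral>\<^sup>+\<sigma>. ennreal (\<delta> \<sigma>) \<partial>count_space A)
      = (\<integral>\<^sup>+\<sigma>. (SUP N. ennreal (\<delta> \<sigma>) * indicator (B N) \<sigma>) \<partial>count_space A)"
  proof (rule nn_integral_cong)
    fix \<sigma> assume "\<sigma> \<in> space (count_space A)"
    hence "\<sigma> \<in> B (length \<sigma>)" by (simp add: B_def)
    hence "ennreal (\<delta> \<sigma>) * indicator (B (length \<sigma>)) \<sigma> = ennreal (\<delta> \<sigma>)" by simp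
    thus "ennreal (\<delta> \<sigma>) = (SUP N. ennreal (\<delta> \<sigma>) * indicator (B N) \<sigma>)"
      by (intro antisym SUP_least) (auto intro: SUP_upper2[of "length \<sigma>"] simp: indicator_def)
  qed
  also have "\<dots> = (SUP N. \<integral>\<^sup>+\<sigma>. ennreal (\<delta> \<sigma>) * indicator (B N) \<sigma> \<partial>count_space A)"
    by (rule nn_integral_monotone_convergence_SUP)
       (auto simp: incseq_def le_fun_def B_def indicator_def)
  also have "\<dots> \<le> ennreal (level_sum \<delta> [] n)"
  proof (rule SUP_least)
    fix N
    let ?L = "{\<sigma> :: bool list. length \<sigma> = n \<and> prefix [] \<sigma>}"
    have "(\<integral>\<^sup>+\<sigma>. ennreal (\<delta> \<sigma>) * indicator (B N) \<sigma> \<partial>count_space A)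
        = (\<Sum>\<sigma>\<in>B N. ennreal (\<delta> \<sigma>) * indicator (B N) \<sigma>)"
      by (rule nn_integral_count_space'[OF fin]) (auto simp: B_def)
    also have "\<dots> = ennreal (sum \<delta> (B N))"
      using nonneg by (simp add: sum_ennreal cong: sum.cong_simp)
    also have "sum \<delta> (B N) \<le> level_sum \<delta> [] n"
    proof -
      \<comment> \<open>Since all members have length at least \<open>n\<close>, each lies above
        exactly one string of level \<open>n\<close>.\<close>
      have B_eq: "B N = (\<Union>\<sigma>\<in>?L. {\<tau>\<in>A. length \<tau> \<le> N \<and> prefix \<sigma> \<tau>})"
      proof -
        have "\<exists>\<sigma>\<in>?L. prefix \<sigma> \<tau>" if "\<tau> \<in> A" for \<tau>
          by (rule bexI[of _ "take n \<tau>"]) (use len[OF that] in \<open>auto simp: take_is_prefix\<close>)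
        thus ?thesis unfolding B_def by blast
      qed
      have "sum \<delta> (B N) = (\<Sum>\<sigma>\<in>?L. \<Sum>\<tau>\<in>{\<tau>\<in>A. length \<tau> \<le> N \<and> prefix \<sigma> \<tau>}. \<delta> \<tau>)"
        unfolding B_eq
      proof (rule sum.UNION_disjoint)
        show "finite ?L" by (rule finite_level)
        show "\<forall>\<sigma>\<in>?L. finite {\<tau>\<in>A. length \<tau> \<le> N \<and> prefix \<sigma> \<tau>}"
          using fin[of N] by (auto simp: B_def intro: finite_subset[rotated])
        show "\<forall>\<sigma>\<in>?L. \<forall>\<mu>\<in>?L. \<sigma> \<noteq> \<mu> \<longrightarrow>
            {\<tau>\<in>A. length \<tau> \<le> N \<and> prefix \<sigma> \<tau>} \<inter> {\<tau>\<in>A. length \<tau> \<le> N \<and> prefix \<mu> \<tau>} = {}"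
          by (auto simp: prefix_def)
      qed
      also have "\<dots> \<le> level_sum \<delta> [] n"
        unfolding level_sum_def
        by (intro sum_mono antichain_sum_le[OF assms(1) nonneg super])
      finally show ?thesis .
    qed
    finally show "(\<integral>\<^sup>+\<sigma>. ennreal (\<delta> \<sigma>) * indicator (B N) \<sigma> \<partial>count_space A)
        \<le> ennreal (level_sum \<delta> [] n)" by (simp add: ennreal_leI)
  qed
  finally show ?thesis .
qed

section \<open>Level limits of a semimeasure\<close>

locale semimeasure_on_strings =
  fixes \<rho> :: "bool list \<Rightarrow> real"
  assumes semimeasure: "semimeasure \<rho>"
begin

lemma nonneg: "0 \<le> \<rho> \<sigma>"
  and superadditive: "\<rho> (\<sigma> @ [False]) + \<rho> (\<sigma> @ [True]) \<le> \<rho> \<sigma>"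
  using semimeasure by (auto simp: semimeasure_def)

lemma level_sum_nonneg: "0 \<le> level_sum \<rho> \<sigma> n"
  by (auto simp: level_sum_def intro: sum_nonneg nonneg)

lemma level_sum_Suc_le:
  assumes "length \<sigma> \<le> n" shows "level_sum \<rho> \<sigma> (Suc n) \<le> level_sum \<rho> \<sigma> n"
  unfolding level_sum_Suc[OF assms] by (auto simp: level_sum_def intro: sum_mono superadditive)

text \<open>The shift by \<open>length \<sigma>\<close> makes the sequence decreasing from index 0;
  on lower levels the sum is empty and equals 0.\<close>

lemma rho_bar_eq_INF: "rho_bar \<rho> \<sigma> = (INF n. level_sum \<rho> \<sigma> (n + length \<sigma>))"
proof -
  have "{length \<sigma>..} = range (\<lambda>n. n + length \<sigma>)"
    by (auto simp: image_iff le_iff_add add.commute)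
  thus ?thesis by (simp add: rho_bar_def level_sum_def image_image)
qed

lemma level_sum_tendsto: "(\<lambda>n. level_sum \<rho> \<sigma> n) \<longlonglongrightarrow> rho_bar \<rho> \<sigma>"
proof -
  have "bdd_below (range (\<lambda>n. level_sum \<rho> \<sigma> (n + length \<sigma>)))"
    by (rule bdd_belowI2) (rule level_sum_nonneg)
  moreover have "decseq (\<lambda>n. level_sum \<rho> \<sigma> (n + length \<sigma>))"
    by (auto intro!: decseq_SucI level_sum_Suc_le)
  ultimately have "(\<lambda>n. level_sum \<rho> \<sigma> (n + length \<sigma>)) \<longlonglongrightarrow> rho_bar \<rho> \<sigma>"
    unfolding rho_bar_eq_INF by (rule LIMSEQ_decseq_INF)
  thus ?thesis by (rule LIMSEQ_offset)
qed

lemma rho_bar_nonneg: "0 \<le> rho_bar \<rho> \<sigma>"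
  by (rule LIMSEQ_le_const[OF level_sum_tendsto]) (auto intro: level_sum_nonneg)

lemma rho_bar_le: "rho_bar \<rho> \<sigma> \<le> \<rho> \<sigma>"
proof -
  have "level_sum \<rho> \<sigma> n \<le> \<rho> \<sigma>" if "length \<sigma> \<le> n" for n
    using that by (induction rule: dec_induct)
      (auto simp: level_sum_self intro: order_trans[OF level_sum_Suc_le])
  thus ?thesis by (intro LIMSEQ_le_const2[OF level_sum_tendsto]) blast
qed

text \<open>Level sums split exactly over the two children on every level beyond
  \<open>length \<sigma>\<close>, and this passes to the limit. So the limit is additive although
  \<open>\<rho>\<close> is only superadditive.\<close>

lemma rho_bar_children: "rho_bar \<rho> \<sigma> = rho_bar \<rho> (\<sigma> @ [False]) + rho_bar \<rho> (\<sigma> @ [True])"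
proof -
  have "(\<lambda>n. level_sum \<rho> (\<sigma> @ [False]) n + level_sum \<rho> (\<sigma> @ [True]) n)
      \<longlonglongrightarrow> rho_bar \<rho> (\<sigma> @ [False]) + rho_bar \<rho> (\<sigma> @ [True])"
    by (intro tendsto_add level_sum_tendsto)
  moreover have "eventually (\<lambda>n. level_sum \<rho> (\<sigma> @ [False]) n + level_sum \<rho> (\<sigma> @ [True]) n
      = level_sum \<rho> \<sigma> n) sequentially"
    using eventually_gt_at_top[of "length \<sigma>"] by eventually_elim (simp add: level_sum_children)
  ultimately have "(\<lambda>n. level_sum \<rho> \<sigma> n) \<longlonglongrightarrow> rho_bar \<rho> (\<sigma> @ [False]) + rho_bar \<rho> (\<sigma> @ [True])"
    by (rule Lim_transform_eventually)
  thus ?thesis using level_sum_tendsto LIMSEQ_unique by blast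
qed

lemma rho_bar_level_sum: "(\<Sum>\<tau>\<in>{\<tau>. length \<tau> = n \<and> prefix [] \<tau>}. rho_bar \<rho> \<tau>) = rho_bar \<rho> []"
proof -
  have "level_sum (rho_bar \<rho>) [] n = rho_bar \<rho> []"
  proof (induction n)
    case 0
    show ?case using level_sum_self[of _ "[]"] by simp
  next
    case (Suc n)
    thus ?case by (simp add: level_sum_Suc rho_bar_children[symmetric])
  qed
  thus ?thesis by (simp add: level_sum_def)
qed

section \<open>Construction of the measure by pushing forward Lebesgue measure\<close>

text \<open>Lebesgue measure on the interval from \<open>0\<close> to the total mass is pushed forward along a map
  sending each point to the sequence whose prefixes index the nested half-open intervals
  \<open>string_interval \<sigma>\<close>, of length \<open>rho_bar \<rho> \<sigma>\<close>, that contain it.\<close>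

definition left_end :: "bool list \<Rightarrow> real" where
  "left_end \<sigma> = (\<Sum>i<length \<sigma>. if \<sigma> ! i then rho_bar \<rho> (take i \<sigma> @ [False]) else 0)"

definition string_interval :: "bool list \<Rightarrow> real set" where
  "string_interval \<sigma> = {left_end \<sigma>..<left_end \<sigma> + rho_bar \<rho> \<sigma>}"

primrec descent :: "real \<Rightarrow> nat \<Rightarrow> bool list" where
  "descent t 0 = []"
| "descent t (Suc n) = descent t n @ [left_end (descent t n @ [True]) \<le> t]"

definition descent_seq :: "real \<Rightarrow> nat \<Rightarrow> bool" where
  "descent_seq t n = last (descent t (Suc n))"

lemma left_end_snoc:
  "left_end (\<sigma> @ [b]) = left_end \<sigma> + (if b then rho_bar \<rho> (\<sigma> @ [False]) else 0)"
  by (auto simp: left_end_def nth_append intro!: sum.cong)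

text \<open>By additivity of \<open>rho_bar\<close>, the half-open intervals of the two children
  partition that of the parent, with cut point \<open>left_end (\<sigma> @ [True])\<close>. A child
  of mass 0 gets the empty interval.\<close>

lemma mem_string_interval_snoc_iff:
  "t \<in> string_interval (\<sigma> @ [b]) \<longleftrightarrow>
     t \<in> string_interval \<sigma> \<and> b = (left_end (\<sigma> @ [True]) \<le> t)"
  using rho_bar_children[of \<sigma>] rho_bar_nonneg[of "\<sigma> @ [False]"] rho_bar_nonneg[of "\<sigma> @ [True]"]
  by (cases b) (auto simp: string_interval_def left_end_snoc)

lemma descent_eq_map: "descent t n = map (descent_seq t) [0..<n]"
proof (induction n)
  case (Suc n)
  have "descent t (Suc n) = descent t n @ [descent_seq t n]" by (simp add: descent_seq_def)
  with Suc show ?case by (simp del: descent.simps)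
qed simp

lemma mem_string_interval_iff:
  assumes "t \<in> string_interval []"
  shows "t \<in> string_interval \<sigma> \<longleftrightarrow> \<sigma> = descent t (length \<sigma>)"
proof (induction \<sigma> rule: rev_induct)
  case Nil
  show ?case using assms by simp
next
  case (snoc b \<sigma>)
  define \<mu> where "\<mu> = descent t (length \<sigma>)"
  have "descent t (length (\<sigma> @ [b])) = \<mu> @ [left_end (\<mu> @ [True]) \<le> t]"
    by (simp add: \<mu>_def)
  thus ?case unfolding mem_string_interval_snoc_iff snoc \<mu>_def[symmetric] by auto
qed

text \<open>Supplies both the measurability of \<open>descent_seq\<close> and the mass of each
  cylinder, as preimages of cylinders are intervals of the right length.\<close>

lemma vimage_cyl:
  "descent_seq -` cyl \<sigma> \<inter> string_interval [] = string_interval \<sigma>"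
proof -
  have sub: "string_interval \<sigma> \<subseteq> string_interval []"
  proof (induction \<sigma> rule: rev_induct)
    case (snoc b \<sigma>)
    thus ?case using mem_string_interval_snoc_iff by blast
  qed simp
  have "descent_seq t \<in> cyl \<sigma> \<longleftrightarrow> t \<in> string_interval \<sigma>" if "t \<in> string_interval []" for t
  proof -
    have "descent_seq t \<in> cyl \<sigma> \<longleftrightarrow> \<sigma> = map (descent_seq t) [0..<length \<sigma>]"
      unfolding cyl_def str_prefix_seq_def mem_Collect_eq by (subst list_eq_iff_nth_eq) auto
    thus ?thesis using mem_string_interval_iff[OF that] descent_eq_map by simp
  qed
  with sub show ?thesis by blast
qed

lemma ex_rho_bar_measure:
  "\<exists>M. space M = UNIV \<and> sets M = sigma_sets UNIV (range cyl) \<and>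
     (\<forall>\<sigma>. emeasure M (cyl \<sigma>) = ennreal (rho_bar \<rho> \<sigma>))"
proof -
  \<comment> \<open>If the total mass is 0, the base interval is empty and \<open>M\<close> is the
    null measure.\<close>
  define L where "L = restrict_space lborel (string_interval [])"
  define M where "M = distr L (sigma UNIV (range cyl)) descent_seq"
  have space_L: "space L = string_interval []"
    by (simp add: L_def space_restrict_space)
  have int: "string_interval \<sigma> \<in> sets lborel" for \<sigma>
    by (simp add: string_interval_def)
  have sub: "string_interval \<sigma> \<subseteq> string_interval []" for \<sigma>
    using vimage_cyl by blast
  have int_L: "string_interval \<sigma> \<in> sets L" for \<sigma>
    unfolding L_def using int sub by (subst sets_restrict_space_iff) auto
  have meas: "descent_seq \<in> measurable L (sigma UNIV (range cyl))"
    by (rule measurable_measure_of) (auto simp: space_L vimage_cyl int_L)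
  have "emeasure M (cyl \<sigma>) = ennreal (rho_bar \<rho> \<sigma>)" for \<sigma>
  proof -
    have "emeasure M (cyl \<sigma>) = emeasure L (string_interval \<sigma>)"
      unfolding M_def by (subst emeasure_distr[OF meas]) (auto simp: space_L vimage_cyl)
    also have "\<dots> = emeasure lborel (string_interval \<sigma>)"
      unfolding L_def using int sub by (intro emeasure_restrict_space) auto
    also have "\<dots> = ennreal (rho_bar \<rho> \<sigma>)"
      using rho_bar_nonneg by (simp add: string_interval_def)
    finally show ?thesis .
  qed
  moreover have "space M = UNIV" "sets M = sigma_sets UNIV (range cyl)"
    by (simp_all add: M_def)
  ultimately show ?thesis by blast
qed

section \<open>Comparison of the semimeasure with the induced measure\<close>

text \<open>Existence of a witness makes the choice in \<open>rho_bar_measure\<close> meet its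
  specification. Everything later rests on these two facts, so it does not matter which witness is
  chosen.\<close>

lemma sets_rho_bar_measure: "sets (rho_bar_measure \<rho>) = sigma_sets UNIV (range cyl)"
  and emeasure_rho_bar_cyl: "emeasure (rho_bar_measure \<rho>) (cyl \<sigma>) = ennreal (rho_bar \<rho> \<sigma>)"
  using someI_ex[OF ex_rho_bar_measure] unfolding rho_bar_measure_def by auto

lemma emeasure_cylset_antichain:
  assumes "antichain A"
  shows "emeasure (rho_bar_measure \<rho>) (cylset A) = (\<integral>\<^sup>+\<sigma>. ennreal (rho_bar \<rho> \<sigma>) \<partial>count_space A)"
  unfolding cylset_def
  by (subst emeasure_UN_countable)
     (auto simp: sets_rho_bar_measure emeasure_rho_bar_cyl disjoint_cyl[OF assms])

text \<open>Subadditivity is obtained by passing to the prefix-minimal strings: their cylinders have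
  the same union and are disjoint, and shrinking the index set only lowers the sum of
  \<open>\<rho>\<close>.\<close>

lemma emeasure_cylset_le: "emeasure (rho_bar_measure \<rho>) (cylset U) \<le> sm_set \<rho> U"
proof -
  have "emeasure (rho_bar_measure \<rho>) (cylset U)
      = (\<integral>\<^sup>+\<sigma>. ennreal (rho_bar \<rho> \<sigma>) \<partial>count_space (prefix_minimal U))"
    using emeasure_cylset_antichain[OF antichain_prefix_minimal, of U]
    by (simp add: cylset_prefix_minimal)
  also have "\<dots> \<le> (\<integral>\<^sup>+\<sigma>. ennreal (\<rho> \<sigma>) \<partial>count_space (prefix_minimal U))"
    by (intro nn_integral_mono ennreal_leI rho_bar_le)
  also have "\<dots> \<le> sm_set \<rho> U"
    unfolding sm_set_def
    by (subst (1 2) nn_integral_count_space_indicator)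
       (auto simp: prefix_minimal_def indicator_def intro!: nn_integral_mono)
  finally show ?thesis .
qed

text \<open>In the splitting of \<open>\<rho>\<close> into \<open>rho_bar \<rho>\<close> and
  \<open>\<delta>\<close>, the first part sums exactly to the measure of the open set. The second is
  superadditive because \<open>rho_bar\<close> is additive, so its sum is controlled by level
  \<open>n\<close>.\<close>

lemma sm_set_antichain_le:
  assumes "antichain A" "\<And>\<sigma>. \<sigma> \<in> A \<Longrightarrow> n \<le> length \<sigma>"
  shows "sm_set \<rho> A \<le> emeasure (rho_bar_measure \<rho>) (cylset A)
      + ennreal (level_sum \<rho> [] n - rho_bar \<rho> [])"
proof -
  define \<delta> where "\<delta> \<sigma> = \<rho> \<sigma> - rho_bar \<rho> \<sigma>" for \<sigma>
  have nonneg: "0 \<le> \<delta> \<sigma>" for \<sigma> using rho_bar_le by (simp add: \<delta>_def)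
  have super: "\<delta> (\<sigma> @ [False]) + \<delta> (\<sigma> @ [True]) \<le> \<delta> \<sigma>" for \<sigma>
    using superadditive[of \<sigma>] rho_bar_children[of \<sigma>] by (simp add: \<delta>_def)
  have "sm_set \<rho> A = (\<integral>\<^sup>+\<sigma>. ennreal (rho_bar \<rho> \<sigma>) + ennreal (\<delta> \<sigma>) \<partial>count_space A)"
    unfolding sm_set_def
    by (intro nn_integral_cong)
       (simp add: \<delta>_def rho_bar_le rho_bar_nonneg flip: ennreal_plus)
  also have "\<dots> = emeasure (rho_bar_measure \<rho>) (cylset A) + (\<integral>\<^sup>+\<sigma>. ennreal (\<delta> \<sigma>) \<partial>count_space A)"
    by (simp add: nn_integral_add emeasure_cylset_antichain[OF assms(1)])
  also have "(\<integral>\<^sup>+\<sigma>. ennreal (\<delta> \<sigma>) \<partial>count_space A) \<le> ennreal (level_sum \<delta> [] n)"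
    by (rule nn_integral_antichain_le[OF assms nonneg super])
  also have "level_sum \<delta> [] n = level_sum \<rho> [] n - rho_bar \<rho> []"
    using rho_bar_level_sum[of n] by (simp add: level_sum_def \<delta>_def sum_subtractf)
  finally show ?thesis by (simp add: add_left_mono)
qed

end

section \<open>Equivalence of the two randomness notions\<close>

theorem theorem6p15:
  fixes \<rho> :: "bool list \<Rightarrow> real" and X :: "nat \<Rightarrow> bool"
  assumes "left_ce_semimeasure \<rho>"
  shows "W2R \<rho> X \<longleftrightarrow> blind_W2R \<rho> X"
proof -
  interpret semimeasure_on_strings \<rho>
    using assms by unfold_locales (simp add: left_ce_semimeasure_def)
  show ?thesis
  proof
    assume W2R: "W2R \<rho> X"
    show "blind_W2R \<rho> X"
      unfolding blind_W2R_def
    proof (intro allI impI, elim conjE)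
      fix \<U> assume \<U>: "unif_eff_open \<U>" "(\<lambda>i. emeasure (rho_bar_measure \<rho>) (\<U> i)) \<longlonglongrightarrow> 0"
      obtain W where "unif_ce W" and W: "\<And>i. \<U> i = cylset (W i)"
        using \<U>(1) unfolding unif_eff_open_def by blast
      \<comment> \<open>\<open>W i\<close> itself may list short or nested strings, whose
        \<open>\<rho>\<close>-sum can be far above the measure of \<open>\<U> i\<close>; the
        antichain of long strings avoids this.\<close>
      obtain V where V: "unif_ce V" "\<And>i. antichain (V i)"
        "\<And>i \<sigma>. \<sigma> \<in> V i \<Longrightarrow> i < length \<sigma>" "\<And>i. cylset (V i) = \<U> i"
        unfolding W using unif_ce_antichain_presentation[OF \<open>unif_ce W\<close>] by blast
      have "(\<lambda>i. level_sum \<rho> [] i - rho_bar \<rho> []) \<longlonglongrightarrow> 0"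
        using level_sum_tendsto LIM_zero by blast
      hence lim: "(\<lambda>i. emeasure (rho_bar_measure \<rho>) (\<U> i)
          + ennreal (level_sum \<rho> [] i - rho_bar \<rho> [])) \<longlonglongrightarrow> 0"
        using tendsto_add[OF \<U>(2) tendsto_ennrealI[of _ 0]] by simp
      have "sm_set \<rho> (V i) \<le> emeasure (rho_bar_measure \<rho>) (\<U> i)
          + ennreal (level_sum \<rho> [] i - rho_bar \<rho> [])" for i
        \<comment> \<open>Members of \<open>V i\<close> are longer than \<open>i\<close>, so the
          error is the excess of level \<open>i\<close>, which tends to 0.\<close>
        using sm_set_antichain_le[OF V(2) less_imp_le[OF V(3)], of i] by (simp only: V(4))
      hence "(\<lambda>i. sm_set \<rho> (V i)) \<longlonglongrightarrow> 0"
        by (intro tendsto_sandwich[OF _ _ tendsto_const lim]) auto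
      with W2R V(1) have "X \<notin> (\<Inter>i. cylset (V i))" unfolding W2R_def by blast
      thus "X \<notin> (\<Inter>i. \<U> i)" by (simp add: V(4))
    qed
  next
    assume blind: "blind_W2R \<rho> X"
    show "W2R \<rho> X"
      unfolding W2R_def
    proof (intro allI impI, elim conjE)
      fix U assume U: "unif_ce U" "(\<lambda>i. sm_set \<rho> (U i)) \<longlonglongrightarrow> 0"
      have "unif_eff_open (\<lambda>i. cylset (U i))"
        unfolding unif_eff_open_def using U(1) by blast
      moreover have "(\<lambda>i. emeasure (rho_bar_measure \<rho>) (cylset (U i))) \<longlonglongrightarrow> 0"
        by (rule tendsto_sandwich[OF _ _ tendsto_const U(2)]) (auto simp: emeasure_cylset_le)
      ultimately show "X \<notin> (\<Inter>i. cylset (U i))"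
        using blind unfolding blind_W2R_def by blast
    qed
  qed
qed

end
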